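(* Let $n\ge 1$ and let $f:\{0,1\}^n\to\{0,1\}$ be a Boolean function that is either constant or balanced. Define $f_0,f_1:\{0,1\}^{n-1}\to\{0,1\}$ by $f_0(u)=f(u0)$ and $f_1(u)=f(u1)$. For $i,b\in\{0,1\}$ let $C_{ib}=|\{u\in\{0,1\}^{n-1} : f_i(u)=b\}|$; for $a,b\in\{0,1\}$ let $B_{ab}=|\{u\in\{0,1\}^{n-1}: f_0(u)=a,\ f_1(u)=b\}|$; and let $M=|\{u\in\{0,1\}^{n-1}: f_0(u)\oplus f_1(u)=0\}|$. Then: (1) $f$ is constant if and only if $C_{00}=C_{10}=2^{n-1}$ or $C_{01}=C_{11}=2^{n-1}$; (2) $f$ is balanced if and only if $B_{00}=B_{11}=M/2$.
   Context: A Boolean function $f:\{0,1\}^n\to\{0,1\}$ is constant if $f\equiv 0$ or $f\equiv 1$, and balanced if $|\{x: f(x)=0\}|=|\{x: f(x)=1\}|=2^{n-1}$. For bit strings $u,w$, $uw$ denotes their concatenation; $\oplus$ is addition modulo 2. *)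

theory Defs
  imports Complex_Main "HOL-Library.Z2"
begin

text \<open>
  The set \<open>{0,1}\<close> is the library type \<^typ>\<open>bit\<close>, whose addition is addition
  modulo 2. Bit strings are lists of bits; a function on \<open>{0,1}\<^sup>n\<close> is a function on
  all bit lists, of which only the values on strings of length \<open>n\<close> are ever used.
\<close>

definition bit_strings :: "nat \<Rightarrow> bit list set" where
  "bit_strings n = {x. length x = n}"

definition constant_fun :: "nat \<Rightarrow> (bit list \<Rightarrow> bit) \<Rightarrow> bool" where
  "constant_fun n f \<longleftrightarrow>
     (\<forall>x\<in>bit_strings n. f x = 0) \<or> (\<forall>x\<in>bit_strings n. f x = 1)"

definition balanced_fun :: "nat \<Rightarrow> (bit list \<Rightarrow> bit) \<Rightarrow> bool" where
  "balanced_fun n f \<longleftrightarrow>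
     card {x \<in> bit_strings n. f x = 0} = card {x \<in> bit_strings n. f x = 1} \<and>
     card {x \<in> bit_strings n. f x = 1} = 2 ^ (n - 1)"

definition last_bit_restr :: "(bit list \<Rightarrow> bit) \<Rightarrow> bit \<Rightarrow> bit list \<Rightarrow> bit" where
  "last_bit_restr f i u = f (u @ [i])"

definition C_count :: "nat \<Rightarrow> (bit list \<Rightarrow> bit) \<Rightarrow> bit \<Rightarrow> bit \<Rightarrow> nat" where
  "C_count n f i b = card {u \<in> bit_strings (n - 1). last_bit_restr f i u = b}"

definition B_count :: "nat \<Rightarrow> (bit list \<Rightarrow> bit) \<Rightarrow> bit \<Rightarrow> bit \<Rightarrow> nat" where
  "B_count n f a b =
     card {u \<in> bit_strings (n - 1). last_bit_restr f 0 u = a \<and> last_bit_restr f 1 u = b}"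

definition M_count :: "nat \<Rightarrow> (bit list \<Rightarrow> bit) \<Rightarrow> nat" where
  "M_count n f =
     card {u \<in> bit_strings (n - 1). last_bit_restr f 0 u + last_bit_restr f 1 u = 0}"

end

theory Submission
  imports Defs
begin

text \<open>
  Splitting strings by their last bit, the fibre of \<open>f\<close> over \<open>b\<close> has \<open>C\<^sub>0\<^sub>b + C\<^sub>1\<^sub>b\<close> elements,
  where \<open>C\<^sub>0\<^sub>b = B\<^sub>b\<^sub>0 + B\<^sub>b\<^sub>1\<close>, \<open>C\<^sub>1\<^sub>b = B\<^sub>0\<^sub>b + B\<^sub>1\<^sub>b\<close> and \<open>C\<^sub>i\<^sub>0 + C\<^sub>i\<^sub>1 = 2\<^sup>n\<^sup>-\<^sup>1\<close>. So \<open>f\<close> is constantly \<open>b\<close>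
  iff both summands attain their maximum \<open>2\<^sup>n\<^sup>-\<^sup>1\<close>. The fibres over 0 and 1 differ in size by
  \<open>2 (B\<^sub>0\<^sub>0 - B\<^sub>1\<^sub>1)\<close>, and \<open>M = B\<^sub>0\<^sub>0 + B\<^sub>1\<^sub>1\<close>.
\<close>

lemma UNIV_bit: "(UNIV :: bit set) = {0, 1}"
  using bit_not_zero_iff by blast

lemma bit_strings_eq_lists: "bit_strings n = {x. set x \<subseteq> UNIV \<and> length x = n}"
  by (simp add: bit_strings_def)

lemma finite_bit_strings [simp]: "finite (bit_strings n)"
  unfolding bit_strings_eq_lists by (rule finite_lists_length_eq) (simp add: UNIV_bit)

lemma card_bit_strings: "card (bit_strings n) = 2 ^ n"
  unfolding bit_strings_eq_lists
  by (subst card_lists_length_eq) (simp_all add: UNIV_bit numeral_2_eq_2)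

text \<open>Reduces each linear relation among the \<open>C\<close>, \<open>B\<close> and
  \<open>M\<close> counts to a pointwise case distinction on bits.\<close>

lemma card_Collect_split:
  assumes "finite A" "\<And>x. x \<in> A \<Longrightarrow> P x \<longleftrightarrow> Q x \<or> R x" "\<And>x. x \<in> A \<Longrightarrow> \<not> (Q x \<and> R x)"
  shows "card {x \<in> A. P x} = card {x \<in> A. Q x} + card {x \<in> A. R x}"
proof -
  have "{x \<in> A. P x} = {x \<in> A. Q x} \<union> {x \<in> A. R x}"
    using assms(2) by blast
  moreover have "{x \<in> A. Q x} \<inter> {x \<in> A. R x} = {}"
    using assms(3) by blast
  ultimately show ?thesis
    using assms(1) by (simp add: card_Un_disjoint)
qed

lemma card_fibre_split:
  "card {x \<in> bit_strings (Suc m). f x = b} = C_count (Suc m) f 0 b + C_count (Suc m) f 1 b"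
proof -
  let ?L = "\<lambda>i. (\<lambda>u. u @ [i]) ` {u \<in> bit_strings m. f (u @ [i]) = b}"
  have "{x \<in> bit_strings (Suc m). f x = b} = ?L 0 \<union> ?L 1"
  proof (intro set_eqI iffI)
    fix x assume x: "x \<in> {x \<in> bit_strings (Suc m). f x = b}"
    then obtain u i where "x = u @ [i]"
      by (cases x rule: rev_cases) (auto simp: bit_strings_def)
    with x show "x \<in> ?L 0 \<union> ?L 1"
      by (cases i) (auto simp: bit_strings_def)
  qed (auto simp: bit_strings_def)
  moreover have "?L 0 \<inter> ?L 1 = {}"
    by auto
  moreover have "card (?L i) = C_count (Suc m) f i b" for i
    by (simp add: C_count_def last_bit_restr_def card_image inj_on_def)
  ultimately show ?thesis
    by (simp add: card_Un_disjoint)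
qed

lemma C_count_sum: "C_count (Suc m) f i 0 + C_count (Suc m) f i 1 = 2 ^ m"
proof -
  \<comment> \<open>The predicate \<open>True\<close> casts the whole set in the form that
    \<open>card_Collect_split\<close> expects.\<close>
  have "card {u \<in> bit_strings m. True} = C_count (Suc m) f i 0 + C_count (Suc m) f i 1"
    unfolding C_count_def diff_Suc_1 by (rule card_Collect_split) auto
  then show ?thesis
    by (simp add: card_bit_strings)
qed

lemma C_count_0_eq: "C_count n f 0 b = B_count n f b 0 + B_count n f b 1"
  unfolding C_count_def B_count_def by (rule card_Collect_split) auto

lemma C_count_1_eq: "C_count n f 1 b = B_count n f 0 b + B_count n f 1 b"
  unfolding C_count_def B_count_def by (rule card_Collect_split) auto

lemma M_count_eq: "M_count n f = B_count n f 0 0 + B_count n f 1 1"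
  unfolding M_count_def B_count_def
proof (rule card_Collect_split)
  have "a + b = 0 \<longleftrightarrow> a = 0 \<and> b = 0 \<or> a = 1 \<and> b = 1" for a b :: bit
    by (cases a; cases b) simp_all
  then show "last_bit_restr f 0 u + last_bit_restr f 1 u = 0 \<longleftrightarrow>
    last_bit_restr f 0 u = 0 \<and> last_bit_restr f 1 u = 0 \<or>
    last_bit_restr f 0 u = 1 \<and> last_bit_restr f 1 u = 1" for u .
qed auto

lemma constant_value_iff:
  "(\<forall>x\<in>bit_strings (Suc m). f x = b) \<longleftrightarrow>
   C_count (Suc m) f 0 b = 2 ^ m \<and> C_count (Suc m) f 1 b = 2 ^ m"
proof -
  let ?S = "{x \<in> bit_strings (Suc m). f x = b}"
  have "(\<forall>x\<in>bit_strings (Suc m). f x = b) \<longleftrightarrow> ?S = bit_strings (Suc m)"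
    by blast
  also have "\<dots> \<longleftrightarrow> card ?S = 2 ^ Suc m"
    using card_subset_eq[of "bit_strings (Suc m)" ?S] card_bit_strings[of "Suc m"] by auto
  also have "\<dots> \<longleftrightarrow> C_count (Suc m) f 0 b + C_count (Suc m) f 1 b = 2 ^ m + 2 ^ m"
    unfolding card_fibre_split power_Suc mult_2 ..
  also have "\<dots> \<longleftrightarrow> C_count (Suc m) f 0 b = 2 ^ m \<and> C_count (Suc m) f 1 b = 2 ^ m"
  proof -
    \<comment> \<open>Two numbers bounded by \<open>2 ^ m\<close> can sum to twice that only if both
      reach the bound.\<close>
    have "C_count (Suc m) f i b \<le> 2 ^ m" for i
      using C_count_sum[of m f i] by (cases b) auto
    from this[of 0] this[of 1] show ?thesis
      by linarith
  qed
  finally show ?thesis .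
qed

lemma balanced_fun_Suc_iff:
  "balanced_fun (Suc m) f \<longleftrightarrow> B_count (Suc m) f 0 0 = B_count (Suc m) f 1 1"
  \<comment> \<open>This instance says that the four \<open>B\<close> counts sum to
    \<open>2 ^ m\<close>. If \<open>B_count\<close> agrees at 00 and 11, the fibre over 1, of size 2
    B11 + B01 + B10, therefore has exactly \<open>2 ^ m\<close> elements.\<close>
  using C_count_sum[of m f 0]
  unfolding balanced_fun_def card_fibre_split C_count_0_eq C_count_1_eq diff_Suc_1
  by linarith

theorem theorem1:
  fixes n :: nat and f :: "bit list \<Rightarrow> bit"
  assumes "n \<ge> 1"
    and "constant_fun n f \<or> balanced_fun n f"
  shows "(constant_fun n f \<longleftrightarrow>
            (C_count n f 0 0 = C_count n f 1 0 \<and> C_count n f 1 0 = 2 ^ (n - 1)) \<or>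
            (C_count n f 0 1 = C_count n f 1 1 \<and> C_count n f 1 1 = 2 ^ (n - 1)))
       \<and> (balanced_fun n f \<longleftrightarrow>
            B_count n f 0 0 = B_count n f 1 1 \<and>
            real (B_count n f 1 1) = real (M_count n f) / 2)"
proof -
  obtain m where n: "n = Suc m"
    using assms(1) by (cases n) auto
  show ?thesis
    \<comment> \<open>As M = B00 + B11, equality of the two summands makes each of them M/2.\<close>
    unfolding n constant_fun_def constant_value_iff balanced_fun_Suc_iff M_count_eq diff_Suc_1
    by auto
qed

end
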